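(* Let $\mathbf Z_{k_A}\in\mathbb D^{d_A}$, $\mathbf Z_{k_B}\in\mathbb D^{d_B}$ and $\mathbf Z_k\in\mathbb D^{d_Ad_B}$ be density matrices with $\mathbf Z_k=\mathbf Z_{k_A}\otimes\mathbf Z_{k_B}$. Then the tensor McCormick inequalities hold: $$\mathbf Z_k\preceq \mathrm{Id}\otimes\mathbf Z_{k_B},\qquad \mathbf Z_k\preceq\mathbf Z_{k_A}\otimes\mathrm{Id},\qquad \mathbf Z_k\succeq \mathrm{Id}\otimes\mathbf Z_{k_B}+\mathbf Z_{k_A}\otimes\mathrm{Id}-\mathrm{Id}.$$
   Context: $\mathbb D^d$ is the set of $d\times d$ complex Hermitian positive semidefinite matrices of trace one; $\otimes$ is the Kronecker product; $\preceq$ is the Loewner order; $\mathrm{Id}$ is the identity matrix of the size determined by context ($d_A$, $d_B$, or $d_Ad_B$). *)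

theory Defs
  imports "Jordan_Normal_Form.Schur_Decomposition"
begin

definition hermitian_mat :: "complex mat \<Rightarrow> bool" where
  "hermitian_mat A \<longleftrightarrow> square_mat A \<and> mat_adjoint A = A"

(* The order on complex is the one of HOL-Library.Complex_Order:
   0 \<le> z means that z is real and nonnegative. *)
definition psd_mat :: "complex mat \<Rightarrow> bool" where
  "psd_mat A \<longleftrightarrow> hermitian_mat A \<and>
     (\<forall>v \<in> carrier_vec (dim_row A). 0 \<le> (A *\<^sub>v v) \<bullet>c v)"

definition mat_trace :: "'a :: comm_monoid_add mat \<Rightarrow> 'a" where
  "mat_trace A = (\<Sum>i<dim_row A. A $$ (i, i))"

definition density_matrices :: "nat \<Rightarrow> complex mat set" where
  "density_matrices d = {Z \<in> carrier_mat d d. psd_mat Z \<and> mat_trace Z = 1}"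

(* Block (p, q) of the product is A $$ (p, q) times B. *)
definition kronecker :: "'a :: times mat \<Rightarrow> 'a mat \<Rightarrow> 'a mat" (infixl \<open>\<otimes>\<^sub>K\<close> 72) where
  "A \<otimes>\<^sub>K B = mat (dim_row A * dim_row B) (dim_col A * dim_col B)
     (\<lambda>(i, j). A $$ (i div dim_row B, j div dim_col B) * B $$ (i mod dim_row B, j mod dim_col B))"

(* B - A always has the dimensions of A, whether or not B has them,
   so equality of dimensions is stated separately. *)
definition loewner_le :: "complex mat \<Rightarrow> complex mat \<Rightarrow> bool" (infix \<open>\<preceq>\<^sub>L\<close> 50) where
  "A \<preceq>\<^sub>L B \<longleftrightarrow> hermitian_mat A \<and> hermitian_mat B \<and> dim_row A = dim_row B \<and> psd_mat (B - A)"

end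

theory Submission
  imports Defs "HOL-Analysis.Convex"
begin

text \<open>
  All three inequalities come from one fact: the Kronecker product of two positive semidefinite
  matrices is positive semidefinite (\<open>psd_mat_kronecker\<close>). By bilinearity, the differences between
  the two sides are \<open>(1 - A) \<otimes> B\<close>, \<open>A \<otimes> (1 - B)\<close> and \<open>(1 - A) \<otimes> (1 - B)\<close>; this is the scalar
  McCormick argument, in which the products \<open>(1 - a) b\<close>, \<open>a (1 - b)\<close> and \<open>(1 - a) (1 - b)\<close> of
  nonnegative numbers are expanded. So it remains to see that \<open>1 - Z\<close> is positive
  semidefinite for a density matrix \<open>Z\<close> (\<open>psd_mat_one_minus_density\<close>).

  Both facts rest on Gram decompositions \<open>A = U U\<^sup>*\<close> (\<open>gram_decomposition\<close>). They multiply under the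
  Kronecker product, \<open>(U U\<^sup>*) \<otimes> (W W\<^sup>*) = (U \<otimes> W) (U \<otimes> W)\<^sup>*\<close>. And if \<open>u\<^sub>k\<close> are the columns
  of \<open>U\<close>, then \<open>x\<^sup>* Z x\<close> is the sum of the \<open>\<bar>\<langle>u\<^sub>k, x\<rangle>\<bar>\<^sup>2\<close>, which by Cauchy-Schwarz is at most the
  squared norm of \<open>x\<close> times the sum of the squared norms of the \<open>u\<^sub>k\<close>, and that sum is the trace
  of \<open>Z\<close>. The Gram decomposition is a Cholesky factorization, obtained by
  eliminating one index at a time.
\<close>

section \<open>Gram decomposition of positive semidefinite Hermitian forms\<close>

text \<open>Kernels on arbitrary finite index sets let the elimination remove any index, where matrices
  would require renumbering.\<close>

definition quad_form :: "'i set \<Rightarrow> ('i \<Rightarrow> 'i \<Rightarrow> complex) \<Rightarrow> ('i \<Rightarrow> complex) \<Rightarrow> complex" where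
  "quad_form S a x = (\<Sum>i\<in>S. cnj (x i) * (\<Sum>j\<in>S. a i j * x j))"

text \<open>Moving along one coordinate changes the form by a quadratic polynomial in the step \<open>t\<close>. Its
  nonnegativity for all \<open>t\<close>, or at the minimizing \<open>t\<close>, is what the elimination uses.\<close>

lemma quad_form_shift:
  assumes fin: "finite S" and p: "p \<in> S"
    and herm: "\<And>i j. i \<in> S \<Longrightarrow> j \<in> S \<Longrightarrow> a j i = cnj (a i j)"
  shows "quad_form S a (\<lambda>i. x i + (if i = p then t else 0)) =
    quad_form S a x + cnj t * (\<Sum>j\<in>S. a p j * x j) + t * cnj (\<Sum>j\<in>S. a p j * x j)
      + cnj t * t * a p p"
proof -
  let ?R = "\<lambda>i. \<Sum>j\<in>S. a i j * x j"
  have row: "(\<Sum>j\<in>S. a i j * (x j + (if j = p then t else 0))) = ?R i + a i p * t" for i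
    using fin p by (simp add: distrib_left sum.distrib if_distrib[of "\<lambda>z. _ * z"] cong: if_cong)
  have col: "(\<Sum>i\<in>S. cnj (x i) * (a i p * t)) = t * cnj (?R p)"
    using herm[OF p] by (simp add: sum_distrib_left mult_ac)
  have "quad_form S a (\<lambda>i. x i + (if i = p then t else 0)) =
      (\<Sum>i\<in>S. (cnj (x i) + (if i = p then cnj t else 0)) * (?R i + a i p * t))"
    unfolding quad_form_def row by (intro sum.cong) auto
  also have "\<dots> = (\<Sum>i\<in>S. cnj (x i) * ?R i) + (\<Sum>i\<in>S. cnj (x i) * (a i p * t))
      + (\<Sum>i\<in>S. (if i = p then cnj t else 0) * (?R i + a i p * t))"
    unfolding sum.distrib[symmetric] by (intro sum.cong) (auto simp: algebra_simps)
  also have "(\<Sum>i\<in>S. (if i = p then cnj t else 0) * (?R i + a i p * t))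
      = cnj t * (?R p + a p p * t)"
    using fin p by (simp add: if_distrib[of "\<lambda>z. z * _"] cong: if_cong)
  finally show ?thesis
    unfolding col quad_form_def[of S a x] by (simp only: algebra_simps)
qed

text \<open>If the diagonal entry vanishes, the polynomial in the step is affine, and an affine function
  that is bounded below has slope zero.\<close>

lemma zero_diag_imp_zero_row:
  assumes fin: "finite S" and p: "p \<in> S" and q: "q \<in> S"
    and herm: "\<And>i j. i \<in> S \<Longrightarrow> j \<in> S \<Longrightarrow> a j i = cnj (a i j)"
    and pos: "\<And>x. 0 \<le> quad_form S a x"
    and zero: "a p p = 0"
  shows "a p q = 0"
proof (rule ccontr)
  assume nz: "a p q \<noteq> 0"
  define e :: "'a \<Rightarrow> complex" where "e i = (if i = q then 1 else 0)" for i
  \<comment> \<open>This step along the coordinate \<open>p\<close>, starting at the unit vector of \<open>q\<close>, brings the form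
    down from \<open>a q q\<close> to exactly \<open>-1\<close>.\<close>
  define s where "s = (Re (a q q) + 1) / (2 * (cmod (a p q))\<^sup>2)"
  define t where "t = - complex_of_real s * a p q"
  have row: "(\<Sum>j\<in>S. a i j * e j) = a i q" for i
    using fin q by (simp add: e_def if_distrib[of "\<lambda>z. _ * z"] cong: if_cong)
  have "quad_form S a e = a q q"
    unfolding quad_form_def row using fin q
    by (simp add: e_def if_distrib[of cnj] if_distrib[of "\<lambda>z. z * _"] cong: if_cong)
  hence "quad_form S a (\<lambda>i. e i + (if i = p then t else 0))
      = a q q + cnj t * a p q + t * cnj (a p q)"
    using quad_form_shift[where a=a and x=e and t=t, OF fin p herm] by (simp add: row zero)
  also have "\<dots> = a q q - complex_of_real (2 * s * (cmod (a p q))\<^sup>2)"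
    unfolding t_def of_real_mult complex_norm_square by (simp add: algebra_simps)
  also have "2 * s * (cmod (a p q))\<^sup>2 = Re (a q q) + 1"
    using nz by (simp add: s_def)
  finally show False
    using pos[of "\<lambda>i. e i + (if i = p then t else 0)"] by (simp add: less_eq_complex_def)
qed

text \<open>The Schur complement at \<open>p\<close> is the form minimized over the coordinate \<open>p\<close>, so it inherits
  nonnegativity. When \<open>a p p = 0\<close>, the division by zero makes it \<open>a\<close> itself.\<close>

lemma quad_form_eliminate:
  assumes fin: "finite S" and p: "p \<in> S"
    and herm: "\<And>i j. i \<in> S \<Longrightarrow> j \<in> S \<Longrightarrow> a j i = cnj (a i j)"
    and pos: "\<And>x. 0 \<le> quad_form S a x"
  shows "0 \<le> quad_form S (\<lambda>i j. a i j - a i p * a p j / a p p) x"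
proof (cases "a p p = 0")
  case True
  then show ?thesis using pos[of x] by simp
next
  case False
  let ?R = "\<Sum>j\<in>S. a p j * x j"
  \<comment> \<open>the minimizing step along the coordinate \<open>p\<close>\<close>
  define t where "t = - ?R / a p p"
  have real: "cnj (a p p) = a p p"
    using herm[OF p p] by simp
  have row: "(\<Sum>j\<in>S. (a i j - a i p * a p j / a p p) * x j)
      = (\<Sum>j\<in>S. a i j * x j) - a i p * ?R / a p p" for i
    by (simp only: left_diff_distrib sum_subtractf sum_distrib_left sum_divide_distrib
        times_divide_eq_left mult.assoc)
  have col: "(\<Sum>i\<in>S. cnj (x i) * a i p) = cnj ?R"
    using herm[OF p] by (simp add: mult_ac)
  have "quad_form S (\<lambda>i j. a i j - a i p * a p j / a p p) x
      = quad_form S a x - (\<Sum>i\<in>S. cnj (x i) * a i p) * ?R / a p p"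
    unfolding quad_form_def row
    by (simp only: right_diff_distrib sum_subtractf sum_distrib_right sum_divide_distrib
        times_divide_eq_right mult.assoc)
  also have "\<dots> = quad_form S a (\<lambda>i. x i + (if i = p then t else 0))"
  proof -
    have "quad_form S a (\<lambda>i. x i + (if i = p then t else 0))
        = quad_form S a x + cnj t * ?R + t * cnj ?R + cnj t * t * a p p"
      by (rule quad_form_shift[OF fin p herm])
    also have "\<dots> = quad_form S a x - cnj ?R * ?R / a p p"
      using False real by (simp add: t_def field_simps del: cnj_sum)
    finally show ?thesis unfolding col ..
  qed
  finally show ?thesis using pos by simp
qed

text \<open>Subtracting the rank-one kernel \<open>a i p * a p j / a p p\<close> leaves a positive semidefinite kernel
  that vanishes on the row and the column of \<open>p\<close>, so it is decomposed over the remaining indices.\<close>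

lemma gram_decomposition:
  assumes "finite S"
    and "\<And>i j. i \<in> S \<Longrightarrow> j \<in> S \<Longrightarrow> a j i = cnj (a i j)"
    and "\<And>x. 0 \<le> quad_form S a x"
  shows "\<exists>u. \<forall>i\<in>S. \<forall>j\<in>S. a i j = (\<Sum>k\<in>S. u k i * cnj (u k j))"
  using assms
proof (induction S arbitrary: a rule: finite_induct)
  case empty
  then show ?case by simp
next
  case (insert p T)
  let ?S = "insert p T"
  note herm = insert.prems(1) and pos = insert.prems(2)
  have fin: "finite ?S" and p: "p \<in> ?S" using insert.hyps by auto
  define b where "b i j = a i j - a i p * a p j / a p p" for i j
  define r where "r = Re (a p p)"
  have appr: "a p p = complex_of_real r"
    using herm[OF p p] by (simp add: r_def complex_eq_iff)
  have zero_row: "a p j = 0" if "a p p = 0" "j \<in> ?S" for j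
    using zero_diag_imp_zero_row[where a=a, OF fin p that(2) herm pos that(1)] by simp
  have "0 \<le> r"
  proof -
    have "quad_form ?S a (\<lambda>i. 0 + (if i = p then 1 else 0)) = a p p"
      using quad_form_shift[where a=a and x="\<lambda>_. 0" and t=1, OF fin p herm]
      by (simp add: quad_form_def[of _ _ "\<lambda>_. 0"])
    then show ?thesis using pos[of "\<lambda>i. 0 + (if i = p then 1 else 0)"]
      by (simp add: r_def less_eq_complex_def)
  qed
  have bherm: "b j i = cnj (b i j)" if "i \<in> T" "j \<in> T" for i j
    using herm[of i j] herm[of i p] herm[of p j] that p by (simp add: b_def appr mult_ac)
  have bpos: "0 \<le> quad_form T b x" for x
  proof -
    let ?x = "\<lambda>i. if i = p then 0 else x i"
    have "0 \<le> quad_form ?S b ?x"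
      using quad_form_eliminate[where a=a, OF fin p herm pos] by (simp add: b_def[abs_def])
    also have "quad_form ?S b ?x = quad_form T b x"
    proof -
      have "(\<Sum>j\<in>T. b i j * ?x j) = (\<Sum>j\<in>T. b i j * x j)" for i
        using insert.hyps by (intro sum.cong) auto
      moreover have "(\<Sum>i\<in>T. cnj (?x i) * f i) = (\<Sum>i\<in>T. cnj (x i) * f i)" for f
        using insert.hyps by (intro sum.cong) auto
      ultimately show ?thesis
        unfolding quad_form_def using insert.hyps by simp
    qed
    finally show ?thesis .
  qed
  obtain u where u: "\<forall>i\<in>T. \<forall>j\<in>T. b i j = (\<Sum>k\<in>T. u k i * cnj (u k j))"
    using insert.IH[of b] bherm bpos by blast
  \<comment> \<open>If \<open>r = 0\<close>, the column of \<open>p\<close> vanishes, and so does the new vector \<open>w p\<close>.\<close>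
  define w where "w k i = (if k = p then a i p / complex_of_real (sqrt r)
    else if i = p then 0 else u k i)" for k i
  have "a i j = (\<Sum>k\<in>?S. w k i * cnj (w k j))" if i: "i \<in> ?S" and j: "j \<in> ?S" for i j
  proof -
    have "w p i * cnj (w p j) = a i p * a p j / a p p"
    proof -
      have "complex_of_real (sqrt r) * complex_of_real (sqrt r) = a p p"
        using \<open>0 \<le> r\<close> by (simp add: appr flip: of_real_mult)
      then show ?thesis using herm[OF j p] by (simp add: w_def)
    qed
    moreover have "(\<Sum>k\<in>T. w k i * cnj (w k j)) = b i j"
    proof (cases "i = p \<or> j = p")
      case True
      have "(\<Sum>k\<in>T. w k i * cnj (w k j)) = 0"
        using True insert.hyps by (intro sum.neutral) (auto simp: w_def)
      moreover have "b i j = 0"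
        using True zero_row[OF _ i] zero_row[OF _ j] herm[OF i p]
        by (cases "a p p = 0") (auto simp: b_def)
      ultimately show ?thesis by simp
    next
      case False
      have "(\<Sum>k\<in>T. w k i * cnj (w k j)) = (\<Sum>k\<in>T. u k i * cnj (u k j))"
        using False insert.hyps by (intro sum.cong) (auto simp: w_def)
      then show ?thesis using u i j False by auto
    qed
    ultimately show ?thesis
      using insert.hyps by (simp add: b_def)
  qed
  then show ?case by blast
qed

section \<open>Positive semidefinite matrices\<close>

lemma hermitian_mat_iff:
  assumes A: "A \<in> carrier_mat n n"
  shows "hermitian_mat A \<longleftrightarrow> (\<forall>i<n. \<forall>j<n. A $$ (j, i) = cnj (A $$ (i, j)))"
proof -
  have adj: "mat_adjoint A \<in> carrier_mat n n"
    "\<And>i j. i < n \<Longrightarrow> j < n \<Longrightarrow> mat_adjoint A $$ (i, j) = cnj (A $$ (j, i))"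
    using A by (auto simp: mat_adjoint_def mat_of_rows_def)
  have "mat_adjoint A = A \<longleftrightarrow> (\<forall>j<n. \<forall>i<n. mat_adjoint A $$ (j, i) = A $$ (j, i))"
    using A adj(1) by (auto simp del: index_mat intro!: eq_matI)
  also have "\<dots> \<longleftrightarrow> (\<forall>i<n. \<forall>j<n. A $$ (j, i) = cnj (A $$ (i, j)))"
    by (simp add: adj(2)) metis
  finally show ?thesis
    using A by (simp add: hermitian_mat_def)
qed

lemma cscalar_prod_quad_form:
  assumes "A \<in> carrier_mat n n" and "v \<in> carrier_vec n"
  shows "(A *\<^sub>v v) \<bullet>c v = quad_form {..<n} (\<lambda>i j. A $$ (i, j)) (\<lambda>i. v $ i)"
  using assms
  by (auto simp: quad_form_def scalar_prod_def lessThan_atLeast0 mult.commute intro!: sum.cong)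

lemma psd_mat_iff:
  assumes A: "A \<in> carrier_mat n n"
  shows "psd_mat A \<longleftrightarrow> hermitian_mat A \<and> (\<forall>x. 0 \<le> quad_form {..<n} (\<lambda>i j. A $$ (i, j)) x)"
proof -
  have "quad_form {..<n} (\<lambda>i j. A $$ (i, j)) x = (A *\<^sub>v vec n x) \<bullet>c vec n x" for x
    unfolding cscalar_prod_quad_form[OF A vec_carrier] quad_form_def
    by (intro sum.cong arg_cong2[where f="(*)"]) auto
  then have "(\<forall>v\<in>carrier_vec n. 0 \<le> (A *\<^sub>v v) \<bullet>c v)
      \<longleftrightarrow> (\<forall>x. 0 \<le> quad_form {..<n} (\<lambda>i j. A $$ (i, j)) x)"
    by (metis cscalar_prod_quad_form[OF A] vec_carrier)
  then show ?thesis
    unfolding psd_mat_def using A by auto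
qed

lemma psd_mat_gram:
  assumes A: "A \<in> carrier_mat n n" and psd: "psd_mat A"
  obtains u where "\<And>i j. i < n \<Longrightarrow> j < n \<Longrightarrow> A $$ (i, j) = (\<Sum>k<n. u k i * cnj (u k j))"
proof -
  have "\<exists>u. \<forall>i\<in>{..<n}. \<forall>j\<in>{..<n}. A $$ (i, j) = (\<Sum>k<n. u k i * cnj (u k j))"
  proof (rule gram_decomposition)
    show "A $$ (j, i) = cnj (A $$ (i, j))" if "i \<in> {..<n}" "j \<in> {..<n}" for i j
      using psd that unfolding psd_mat_iff[OF A] hermitian_mat_iff[OF A] by blast
    show "0 \<le> quad_form {..<n} (\<lambda>i j. A $$ (i, j)) x" for x
      using psd unfolding psd_mat_iff[OF A] by blast
  qed simp
  then show thesis using that by blast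
qed

text \<open>The form of \<open>U U\<^sup>*\<close> at \<open>x\<close> is the squared norm of \<open>U\<^sup>* x\<close>.\<close>

lemma quad_form_gram:
  fixes u :: "'k \<Rightarrow> 'i \<Rightarrow> complex"
  assumes "\<And>i j. i \<in> S \<Longrightarrow> j \<in> S \<Longrightarrow> a i j = (\<Sum>k\<in>K. u k i * cnj (u k j))"
  shows "quad_form S a x = complex_of_real (\<Sum>k\<in>K. (cmod (\<Sum>j\<in>S. cnj (u k j) * x j))\<^sup>2)"
proof -
  have "quad_form S a x
      = (\<Sum>i\<in>S. cnj (x i) * (\<Sum>j\<in>S. (\<Sum>k\<in>K. u k i * cnj (u k j)) * x j))"
    unfolding quad_form_def using assms by simp
  also have "\<dots> = (\<Sum>i\<in>S. \<Sum>j\<in>S. \<Sum>k\<in>K. (cnj (x i) * u k i) * (cnj (u k j) * x j))"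
    by (simp add: sum_distrib_left sum_distrib_right mult_ac)
  also have "\<dots> = (\<Sum>i\<in>S. \<Sum>k\<in>K. \<Sum>j\<in>S. (cnj (x i) * u k i) * (cnj (u k j) * x j))"
    by (intro sum.cong refl sum.swap)
  also have "\<dots> = (\<Sum>k\<in>K. \<Sum>i\<in>S. \<Sum>j\<in>S. (cnj (x i) * u k i) * (cnj (u k j) * x j))"
    by (rule sum.swap)
  also have "\<dots> = (\<Sum>k\<in>K. (\<Sum>i\<in>S. cnj (x i) * u k i) * (\<Sum>j\<in>S. cnj (u k j) * x j))"
    by (simp only: sum_product)
  also have "\<dots> = (\<Sum>k\<in>K. (\<Sum>j\<in>S. cnj (u k j) * x j) * cnj (\<Sum>j\<in>S. cnj (u k j) * x j))"
    by (simp add: mult.commute)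
  finally show ?thesis
    by (simp only: of_real_sum complex_norm_square)
qed

text \<open>Here the vectors may be indexed by any type, so that a Kronecker product can use pairs.\<close>

lemma psd_mat_gramI:
  assumes A: "A \<in> carrier_mat n n"
    and gram: "\<And>i j. i < n \<Longrightarrow> j < n \<Longrightarrow> A $$ (i, j) = (\<Sum>k\<in>K. u k i * cnj (u k j))"
  shows "psd_mat A"
proof -
  have "0 \<le> quad_form {..<n} (\<lambda>i j. A $$ (i, j)) x" for x
    using quad_form_gram[where S="{..<n}" and a="\<lambda>i j. A $$ (i, j)" and u=u and K=K and x=x] gram
    by (simp add: sum_nonneg less_eq_complex_def)
  then show ?thesis
    unfolding psd_mat_iff[OF A] hermitian_mat_iff[OF A] by (simp add: gram mult.commute)
qed

lemma psd_mat_one: "psd_mat (1\<^sub>m n)"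
  by (rule psd_mat_gramI[where n=n and K="{..<n}" and u="\<lambda>k i. if k = i then 1 else 0"])
     (auto simp: if_distrib[of "\<lambda>z. z * _"] cong: if_cong)

lemma hermitian_mat_minus:
  assumes "A \<in> carrier_mat n n" "hermitian_mat A" "B \<in> carrier_mat n n" "hermitian_mat B"
  shows "hermitian_mat (A - B)"
proof -
  have car: "A - B \<in> carrier_mat n n" using assms(3) by (rule minus_carrier_mat)
  have idx: "(A - B) $$ (i, j) = A $$ (i, j) - B $$ (i, j)" if "i < n" "j < n" for i j
    using that assms(1,3) by simp
  have "(A - B) $$ (j, i) = cnj ((A - B) $$ (i, j))" if ij: "i < n" "j < n" for i j
    unfolding idx[OF ij] idx[OF ij(2,1)] complex_cnj_diff
    using ij assms(2,4) unfolding hermitian_mat_iff[OF assms(1)] hermitian_mat_iff[OF assms(3)]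
    by metis
  then show ?thesis unfolding hermitian_mat_iff[OF car] by blast
qed

text \<open>The largest eigenvalue of a positive semidefinite matrix is at most its trace. In terms of a Gram
  decomposition this is the Cauchy-Schwarz inequality for each vector, since the trace is the sum of
  the squared norms of the vectors.\<close>

lemma psd_mat_one_minus_density:
  assumes "Z \<in> density_matrices n"
  shows "psd_mat (1\<^sub>m n - Z)"
proof -
  have Z: "Z \<in> carrier_mat n n" "psd_mat Z" and tr: "mat_trace Z = 1"
    using assms by (auto simp: density_matrices_def)
  obtain u where u: "\<And>i j. i < n \<Longrightarrow> j < n \<Longrightarrow> Z $$ (i, j) = (\<Sum>k<n. u k i * cnj (u k j))"
    using psd_mat_gram[OF Z] by blast
  have "complex_of_real (\<Sum>k<n. \<Sum>i<n. (cmod (u k i))\<^sup>2) = (\<Sum>k<n. \<Sum>i<n. u k i * cnj (u k i))"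
    by (simp only: of_real_sum complex_norm_square)
  also have "\<dots> = (\<Sum>i<n. \<Sum>k<n. u k i * cnj (u k i))"
    by (rule sum.swap)
  also have "\<dots> = mat_trace Z"
    using Z u by (simp add: mat_trace_def)
  finally have norm_u: "(\<Sum>k<n. \<Sum>i<n. (cmod (u k i))\<^sup>2) = 1"
    unfolding tr of_real_eq_1_iff .
  have "0 \<le> quad_form {..<n} (\<lambda>i j. (1\<^sub>m n - Z) $$ (i, j)) x" for x
  proof -
    have one: "quad_form {..<n} (\<lambda>i j. 1\<^sub>m n $$ (i, j)) x = complex_of_real (\<Sum>i<n. (cmod (x i))\<^sup>2)"
    proof -
      have row: "(\<Sum>j<n. 1\<^sub>m n $$ (i, j) * x j) = x i" if "i < n" for i
      proof -
        have "(\<Sum>j<n. 1\<^sub>m n $$ (i, j) * x j) = (\<Sum>j<n. if j = i then x j else 0)"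
          using that by (intro sum.cong) auto
        then show ?thesis using that by simp
      qed
      show ?thesis
        unfolding quad_form_def of_real_sum complex_norm_square
        by (rule sum.cong[OF refl], subst row) (simp_all add: mult.commute)
    qed
    have "(\<Sum>k<n. (cmod (\<Sum>j<n. cnj (u k j) * x j))\<^sup>2)
        \<le> (\<Sum>k<n. (\<Sum>i<n. (cmod (u k i))\<^sup>2) * (\<Sum>i<n. (cmod (x i))\<^sup>2))"
    proof (rule sum_mono)
      fix k
      have "(cmod (\<Sum>j<n. cnj (u k j) * x j))\<^sup>2 \<le> (\<Sum>j<n. cmod (u k j) * cmod (x j))\<^sup>2"
        by (intro power_mono sum_norm_le) (auto simp: norm_mult)
      also have "\<dots> \<le> (\<Sum>i<n. (cmod (u k i))\<^sup>2) * (\<Sum>i<n. (cmod (x i))\<^sup>2)"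
        by (rule Cauchy_Schwarz_ineq_sum)
      finally show "(cmod (\<Sum>j<n. cnj (u k j) * x j))\<^sup>2
        \<le> (\<Sum>i<n. (cmod (u k i))\<^sup>2) * (\<Sum>i<n. (cmod (x i))\<^sup>2)" .
    qed
    also have "\<dots> = (\<Sum>i<n. (cmod (x i))\<^sup>2)"
      unfolding sum_distrib_right[symmetric] norm_u by simp
    finally have "quad_form {..<n} (\<lambda>i j. Z $$ (i, j)) x \<le> quad_form {..<n} (\<lambda>i j. 1\<^sub>m n $$ (i, j)) x"
      unfolding one
      using quad_form_gram[where S="{..<n}" and a="\<lambda>i j. Z $$ (i, j)" and u=u and K="{..<n}" and x=x] u
      by (simp add: less_eq_complex_def)
    moreover have "quad_form {..<n} (\<lambda>i j. (1\<^sub>m n - Z) $$ (i, j)) x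
        = quad_form {..<n} (\<lambda>i j. 1\<^sub>m n $$ (i, j)) x - quad_form {..<n} (\<lambda>i j. Z $$ (i, j)) x"
      unfolding quad_form_def sum_subtractf[symmetric] right_diff_distrib[symmetric]
      using Z by (intro sum.cong refl arg_cong2[where f="(*)"]) (auto simp: left_diff_distrib)
    ultimately show ?thesis by simp
  qed
  moreover have "1\<^sub>m n - Z \<in> carrier_mat n n" using Z by auto
  moreover have "hermitian_mat (1\<^sub>m n - Z)"
    using Z psd_mat_one by (intro hermitian_mat_minus[of _ n]) (auto simp: psd_mat_def)
  ultimately show ?thesis by (simp add: psd_mat_iff)
qed

section \<open>Kronecker products\<close>

lemma div_mod_less_mult:
  fixes i m n :: nat
  assumes "i < m * n"
  shows "i div n < m" and "i mod n < n"
proof -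
  have "0 < n" using assms by (cases n) auto
  then show "i mod n < n" by simp
  show "i div n < m" using assms by (simp add: less_mult_imp_div_less)
qed

lemma kronecker_carrier:
  "A \<in> carrier_mat m m \<Longrightarrow> B \<in> carrier_mat n n \<Longrightarrow> A \<otimes>\<^sub>K B \<in> carrier_mat (m * n) (m * n)"
  by (auto simp: kronecker_def)

lemma kronecker_index:
  assumes "A \<in> carrier_mat m m" and "B \<in> carrier_mat n n" and "i < m * n" and "j < m * n"
  shows "(A \<otimes>\<^sub>K B) $$ (i, j) = A $$ (i div n, j div n) * B $$ (i mod n, j mod n)"
  using assms by (auto simp: kronecker_def)

text \<open>The products of the Gram vectors of the factors are Gram vectors of the Kronecker product.\<close>

lemma psd_mat_kronecker:
  assumes A: "A \<in> carrier_mat m m" "psd_mat A" and B: "B \<in> carrier_mat n n" "psd_mat B"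
  shows "psd_mat (A \<otimes>\<^sub>K B)"
proof -
  obtain u where u: "\<And>i j. i < m \<Longrightarrow> j < m \<Longrightarrow> A $$ (i, j) = (\<Sum>k<m. u k i * cnj (u k j))"
    using psd_mat_gram[OF A] by blast
  obtain w where w: "\<And>i j. i < n \<Longrightarrow> j < n \<Longrightarrow> B $$ (i, j) = (\<Sum>k<n. w k i * cnj (w k j))"
    using psd_mat_gram[OF B] by blast
  let ?z = "\<lambda>(k, l) i. u k (i div n) * w l (i mod n)"
  show ?thesis
  proof (rule psd_mat_gramI[OF kronecker_carrier[OF A(1) B(1)]])
    fix i j assume ij: "i < m * n" "j < m * n"
    show "(A \<otimes>\<^sub>K B) $$ (i, j) = (\<Sum>kl\<in>{..<m} \<times> {..<n}. ?z kl i * cnj (?z kl j))"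
      unfolding kronecker_index[OF A(1) B(1) ij]
        u[OF div_mod_less_mult(1)[OF ij(1)] div_mod_less_mult(1)[OF ij(2)]]
        w[OF div_mod_less_mult(2)[OF ij(1)] div_mod_less_mult(2)[OF ij(2)]]
      by (simp add: sum_product sum.cartesian_product mult_ac split_def)
  qed
qed

lemma minus_kronecker:
  assumes "A \<in> carrier_mat m m" "B \<in> carrier_mat m m" "C \<in> carrier_mat n n"
  shows "(A - B) \<otimes>\<^sub>K C = A \<otimes>\<^sub>K C - (B \<otimes>\<^sub>K C :: 'a :: ring mat)"
  using assms
  by (intro eq_matI) (auto simp: kronecker_def left_diff_distrib div_mod_less_mult)

lemma kronecker_minus:
  assumes "A \<in> carrier_mat m m" "B \<in> carrier_mat n n" "C \<in> carrier_mat n n"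
  shows "A \<otimes>\<^sub>K (B - C) = A \<otimes>\<^sub>K B - (A \<otimes>\<^sub>K C :: 'a :: ring mat)"
  using assms
  by (intro eq_matI) (auto simp: kronecker_def right_diff_distrib div_mod_less_mult)

lemma kronecker_one: "1\<^sub>m m \<otimes>\<^sub>K 1\<^sub>m n = (1\<^sub>m (m * n) :: 'a :: ring_1 mat)"
proof (rule eq_matI)
  fix i j assume ij: "i < dim_row (1\<^sub>m (m * n) :: 'a mat)" "j < dim_col (1\<^sub>m (m * n) :: 'a mat)"
  have "i = j \<longleftrightarrow> i div n = j div n \<and> i mod n = j mod n"
    by (metis div_mult_mod_eq)
  then show "(1\<^sub>m m \<otimes>\<^sub>K 1\<^sub>m n) $$ (i, j) = (1\<^sub>m (m * n) :: 'a mat) $$ (i, j)"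
    using ij div_mod_less_mult by (auto simp: kronecker_def)
qed (auto simp: kronecker_def)

section \<open>The tensor McCormick inequalities\<close>

theorem proposition7:
  fixes d\<^sub>A d\<^sub>B :: nat and Zk Zk\<^sub>A Zk\<^sub>B :: "complex mat"
  assumes "Zk\<^sub>A \<in> density_matrices d\<^sub>A"
    and "Zk\<^sub>B \<in> density_matrices d\<^sub>B"
    and "Zk \<in> density_matrices (d\<^sub>A * d\<^sub>B)"
    and "Zk = Zk\<^sub>A \<otimes>\<^sub>K Zk\<^sub>B"
  shows "Zk \<preceq>\<^sub>L 1\<^sub>m d\<^sub>A \<otimes>\<^sub>K Zk\<^sub>B
    \<and> Zk \<preceq>\<^sub>L Zk\<^sub>A \<otimes>\<^sub>K 1\<^sub>m d\<^sub>B
    \<and> 1\<^sub>m d\<^sub>A \<otimes>\<^sub>K Zk\<^sub>B + Zk\<^sub>A \<otimes>\<^sub>K 1\<^sub>m d\<^sub>B - 1\<^sub>m (d\<^sub>A * d\<^sub>B) \<preceq>\<^sub>L Zk"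
proof -
  let ?IA = "1\<^sub>m d\<^sub>A :: complex mat" and ?IB = "1\<^sub>m d\<^sub>B :: complex mat"
  have A: "Zk\<^sub>A \<in> carrier_mat d\<^sub>A d\<^sub>A" "psd_mat Zk\<^sub>A" and B: "Zk\<^sub>B \<in> carrier_mat d\<^sub>B d\<^sub>B" "psd_mat Zk\<^sub>B"
    using assms by (auto simp: density_matrices_def)
  have A': "?IA - Zk\<^sub>A \<in> carrier_mat d\<^sub>A d\<^sub>A" "psd_mat (?IA - Zk\<^sub>A)"
    and B': "?IB - Zk\<^sub>B \<in> carrier_mat d\<^sub>B d\<^sub>B" "psd_mat (?IB - Zk\<^sub>B)"
    using A B assms psd_mat_one_minus_density by auto
  have IA: "?IA \<in> carrier_mat d\<^sub>A d\<^sub>A" "psd_mat ?IA" and IB: "?IB \<in> carrier_mat d\<^sub>B d\<^sub>B" "psd_mat ?IB"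
    using psd_mat_one by auto
  note psd = psd_mat_kronecker[OF A B] psd_mat_kronecker[OF IA B] psd_mat_kronecker[OF A IB]
  note car = kronecker_carrier[OF A(1) B(1)] kronecker_carrier[OF IA(1) B(1)]
    kronecker_carrier[OF A(1) IB(1)]
  have herm: "hermitian_mat (Zk\<^sub>A \<otimes>\<^sub>K Zk\<^sub>B)" "hermitian_mat (?IA \<otimes>\<^sub>K Zk\<^sub>B)" "hermitian_mat (Zk\<^sub>A \<otimes>\<^sub>K ?IB)"
    using psd by (auto simp: psd_mat_def)
  have 1: "?IA \<otimes>\<^sub>K Zk\<^sub>B - Zk\<^sub>A \<otimes>\<^sub>K Zk\<^sub>B = (?IA - Zk\<^sub>A) \<otimes>\<^sub>K Zk\<^sub>B"
    by (rule minus_kronecker[OF IA(1) A(1) B(1), symmetric])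
  have 2: "Zk\<^sub>A \<otimes>\<^sub>K ?IB - Zk\<^sub>A \<otimes>\<^sub>K Zk\<^sub>B = Zk\<^sub>A \<otimes>\<^sub>K (?IB - Zk\<^sub>B)"
    by (rule kronecker_minus[OF A(1) IB(1) B(1), symmetric])
  let ?L = "?IA \<otimes>\<^sub>K Zk\<^sub>B + Zk\<^sub>A \<otimes>\<^sub>K ?IB - 1\<^sub>m (d\<^sub>A * d\<^sub>B)"
  have compl: "(?IA - Zk\<^sub>A) \<otimes>\<^sub>K (?IB - Zk\<^sub>B)
      = 1\<^sub>m (d\<^sub>A * d\<^sub>B) - Zk\<^sub>A \<otimes>\<^sub>K ?IB - (?IA \<otimes>\<^sub>K Zk\<^sub>B - Zk\<^sub>A \<otimes>\<^sub>K Zk\<^sub>B)"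
    unfolding kronecker_minus[OF A'(1) IB(1) B(1)] minus_kronecker[OF IA(1) A(1) IB(1)]
      minus_kronecker[OF IA(1) A(1) B(1)] kronecker_one ..
  have 3: "Zk\<^sub>A \<otimes>\<^sub>K Zk\<^sub>B - ?L = (?IA - Zk\<^sub>A) \<otimes>\<^sub>K (?IB - Zk\<^sub>B)"
    unfolding compl using car by (intro eq_matI) auto
  \<comment> \<open>The same identity shows that the lower bound is Hermitian, as a difference of two Hermitian
    matrices.\<close>
  have "hermitian_mat ?L"
  proof -
    have "?L = Zk\<^sub>A \<otimes>\<^sub>K Zk\<^sub>B - (?IA - Zk\<^sub>A) \<otimes>\<^sub>K (?IB - Zk\<^sub>B)"
      unfolding compl using car by (intro eq_matI) auto
    then show ?thesis
      using hermitian_mat_minus[OF car(1) herm(1) kronecker_carrier[OF A'(1) B'(1)]]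
        psd_mat_kronecker[OF A' B'] by (simp add: psd_mat_def)
  qed
  then show ?thesis
    unfolding assms(4) loewner_le_def 1 2 3
    using herm car psd_mat_kronecker[OF A' B] psd_mat_kronecker[OF A B'] psd_mat_kronecker[OF A' B']
    by auto
qed

end
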